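(* Let $B$ be an algebra and let $(\mathcal{H},\underline{S})$ be a full Hopf algebroid over $B$, with underlying $B$-bialgebroid $(\mathcal{H},s,t,\underline{\Delta},\underline{\epsilon})$. Let $\underline{S}':\mathcal{H}\to\mathcal{H}$ be a map. Then $(\mathcal{H},\underline{S}')$ is a full Hopf algebroid over $B$ with the same underlying $B$-bialgebroid structure if and only if there exists a twist $\phi_*\in\mathcal{T}^*$ of $\mathcal{H}$ such that $$\underline{S}'(h)=\underline{S}(h\triangleleft\phi_* )\qquad\text{for all } h\in\mathcal{H}.$$
   Context: $\mathbb{K}$ is a field, algebras are unital associative over $\mathbb{K}$, $\otimes=\otimes_{\mathbb{K}}$. Sweedler-type notations denote sums. **Bialgebroid.** Let $B$ be an algebra. A $B^e$-ring $(\mathcal{H},s,t)$ is an algebra $\mathcal{H}$ with an algebra morphism $s:B\to\mathcal{H}$ (source) and an anti-algebra morphism $t:B\to\mathcal{H}$ (target) such that $s(b)t(b')=t(b')s(b)$ for all $b,b'\in B$. Then $\mathcal{H}$ is a $B$-bimodule by $b\,h\,b':=s(b)t(b')h$, and $\mathcal{H}\otimes_B\mathcal{H}$ is the quotient of $\mathcal{H}\otimes\mathcal{H}$ by the span of all $t(b)h\otimes h'-h\otimes s(b)h'$. A (left) $B$-bialgebroid $(\mathcal{H},s,t,\underline{\Delta},\underline{\epsilon})$ is a $B^e$-ring with $B$-bimodule maps $\underline{\Delta}:\mathcal{H}\to\mathcal{H}\otimes_B\mathcal{H}$, $h\mapsto h_{(1)}\otimes_B h_{(2)}$, and $\underline{\epsilon}:\mathcal{H}\to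 B$ such that: $\underline{\Delta}$ is coassociative; $s(\underline{\epsilon}(h_{(1)}))h_{(2)}=h=t(\underline{\epsilon}(h_{(2)}))h_{(1)}$; $\underline{\Delta}$ takes values in $\mathcal{H}\times_B\mathcal{H}=\{\sum h\otimes_B h' \mid \sum ht(b)\otimes_B h'=\sum h\otimes_B h's(b)\ \forall b\in B\}$ (an algebra under component-wise multiplication) and is an algebra morphism into it; $\underline{\epsilon}(1_{\mathcal{H}})=1_B$ and $\underline{\epsilon}(hh')=\underline{\epsilon}(hs(\underline{\epsilon}(h')))=\underline{\epsilon}(ht(\underline{\epsilon}(h')))$ for all $h,h'\in\mathcal{H}$. **Antipode, full Hopf algebroid.** An antipode for $\mathcal{H}$ is a bijective anti-algebra morphism $\underline{S}:\mathcal{H}\to\mathcal{H}$ with $\underline{S}\circ t=s$ and, for all $h\in\mathcal{H}$, $$\underline{S}(h_{(1)})_{(1')}h_{(2)}\otimes_B\underline{S}(h_{(1)})_{(2')}=1_{\mathcal{H}}\otimes_B\underline{S}(h),\qquad \underline{S}^{-1}(h_{(2)})_{(1')}\otimes_B\underline{S}^{-1}(h_{(2)})_{(2')}h_{(1)}=\underline{S}^{-1}(h)\otimes_B1_{\mathcal{H}},$$ where primed indices denote a further application of $\underline{\Delta}$. A $B$-bialgebroid equipped with an antipode is a full Hopf algebroid $(\mathcal{H},\underline{S})$ over $B$. **Twists.** The convolution algebra $\mathcal{H}^*$ consists of the right $B$-linear maps $\phi_*:\mathcal{H}\to B$ (i.e. linear with $\phi_*(t(b)h)=\phi_*(h)b$),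 with product $(\phi_*\psi_* )(h)=\psi_*\big(s(\phi_*(h_{(1)}))h_{(2)}\big)$ and unit $\underline{\epsilon}$. It acts from the right on $\mathcal{H}$ by $h\triangleleft\phi_*:=s(\phi_*(h_{(1)}))h_{(2)}$. A twist is an invertible element $\phi_*$ of $\mathcal{H}^*$ such that $1_{\mathcal{H}}\triangleleft\phi_*=1_{\mathcal{H}}$ and $(h\triangleleft\phi_* )(h'\triangleleft\phi_* )=(hh')\triangleleft\phi_*$ for all $h,h'\in\mathcal{H}$. The group of twists is denoted $\mathcal{T}^*$. *)

theory Defs
  imports Complex_Main "HOL-Library.Poly_Mapping" "HOL-Library.Set_Algebras"
begin

section \<open>Algebras over a field\<close>

text \<open>The sort \<open>{ring, monoid_mult}\<close> is that of unital associative rings; in contrast to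
  \<open>ring_1\<close> it does not exclude the zero ring.\<close>

locale assoc_algebra = vector_space scale
  for scale :: "'k::field \<Rightarrow> 'a::{ring, monoid_mult} \<Rightarrow> 'a" +
  assumes scale_mult_left: "scale c x * y = scale c (x * y)"
    and scale_mult_right: "x * scale c y = scale c (x * y)"

definition algebra_morphism ::
  "('k::field \<Rightarrow> 'a::{ring, monoid_mult} \<Rightarrow> 'a) \<Rightarrow> ('k \<Rightarrow> 'c::{ring, monoid_mult} \<Rightarrow> 'c)
    \<Rightarrow> ('a \<Rightarrow> 'c) \<Rightarrow> bool" where
  "algebra_morphism scA scC f \<longleftrightarrow>
     Vector_Spaces.linear scA scC f \<and> f 1 = 1 \<and> (\<forall>x y. f (x * y) = f x * f y)"

definition anti_algebra_morphism ::
  "('k::field \<Rightarrow> 'a::{ring, monoid_mult} \<Rightarrow> 'a) \<Rightarrow> ('k \<Rightarrow> 'c::{ring, monoid_mult} \<Rightarrow> 'c)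
    \<Rightarrow> ('a \<Rightarrow> 'c) \<Rightarrow> bool" where
  "anti_algebra_morphism scA scC f \<longleftrightarrow>
     Vector_Spaces.linear scA scC f \<and> f 1 = 1 \<and> (\<forall>x y. f (x * y) = f y * f x)"


section \<open>Free vector spaces\<close>

text \<open>\<open>'x \<Rightarrow>\<^sub>0 'k\<close> is the vector space with basis \<open>'x\<close>; \<open>gen p\<close> is the basis vector of \<open>p\<close>.
  \<open>lin_ext scV f\<close> is the linear extension of a map \<open>f\<close> from the basis to the vector space with
  scalar multiplication \<open>scV\<close>.\<close>

definition pm_scale :: "'k::field \<Rightarrow> ('x \<Rightarrow>\<^sub>0 'k) \<Rightarrow> ('x \<Rightarrow>\<^sub>0 'k)" where
  "pm_scale c u = Poly_Mapping.map ((*) c) u"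

definition gen :: "'x \<Rightarrow> ('x \<Rightarrow>\<^sub>0 'k::field)" where
  "gen p = Poly_Mapping.single p 1"

definition lin_ext ::
  "('k::field \<Rightarrow> 'v::ab_group_add \<Rightarrow> 'v) \<Rightarrow> ('x \<Rightarrow> 'v) \<Rightarrow> ('x \<Rightarrow>\<^sub>0 'k) \<Rightarrow> 'v" where
  "lin_ext scV f u = (\<Sum>p\<in>Poly_Mapping.keys u. scV (Poly_Mapping.lookup u p) (f p))"

abbreviation pm_ext :: "('x \<Rightarrow> ('y \<Rightarrow>\<^sub>0 'k)) \<Rightarrow> ('x \<Rightarrow>\<^sub>0 'k::field) \<Rightarrow> ('y \<Rightarrow>\<^sub>0 'k)" where
  "pm_ext \<equiv> lin_ext pm_scale"

lemma vector_space_pm_scale: "vector_space (pm_scale :: 'k::field \<Rightarrow> ('x \<Rightarrow>\<^sub>0 'k) \<Rightarrow> _)"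
proof -
  have lookup: "Poly_Mapping.lookup (pm_scale c u) p = c * Poly_Mapping.lookup u p"
    for c :: 'k and u and p :: 'x
    by (simp add: pm_scale_def Poly_Mapping.map.rep_eq when_def)
  show ?thesis
    by unfold_locales (auto intro!: poly_mapping_eqI simp: lookup lookup_add algebra_simps)
qed


section \<open>Rings over the enveloping algebra and their tensor products\<close>

locale Be_ring = B: assoc_algebra scaleB + H: assoc_algebra scaleH
  for scaleB :: "'k::field \<Rightarrow> 'b::{ring, monoid_mult} \<Rightarrow> 'b"
    and scaleH :: "'k \<Rightarrow> 'h::{ring, monoid_mult} \<Rightarrow> 'h" +
  fixes s :: "'b \<Rightarrow> 'h" and t :: "'b \<Rightarrow> 'h"
  assumes source: "algebra_morphism scaleB scaleH s"
    and target: "anti_algebra_morphism scaleB scaleH t"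
    and source_target_commute: "s b * t b' = t b' * s b"
begin

text \<open>\<open>H \<otimes>\<^sub>B H\<close> is the free vector space on \<open>H \<times> H\<close> modulo the span \<open>null2\<close> of the bilinearity
  relations (which yield \<open>H \<otimes> H\<close> over the base field) and of the relations
  \<open>t b x \<otimes> y - x \<otimes> s b y\<close>. An element is represented by the coset \<open>cls2 u\<close> of a formal sum \<open>u\<close>;
  the class of \<open>gen (x, y)\<close> is the tensor of \<open>x\<close> and \<open>y\<close>. \<open>H \<otimes>\<^sub>B H \<otimes>\<^sub>B H\<close> is built in the same way.\<close>

definition null2 :: "(('h \<times> 'h) \<Rightarrow>\<^sub>0 'k) set" where
  "null2 = module.span pm_scale
     ({gen (x + x', y) - gen (x, y) - gen (x', y) | x x' y. True}
    \<union> {gen (x, y + y') - gen (x, y) - gen (x, y') | x y y'. True}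
    \<union> {gen (scaleH c x, y) - pm_scale c (gen (x, y)) | c x y. True}
    \<union> {gen (x, scaleH c y) - pm_scale c (gen (x, y)) | c x y. True}
    \<union> {gen (t b * x, y) - gen (x, s b * y) | b x y. True})"

definition cls2 :: "(('h \<times> 'h) \<Rightarrow>\<^sub>0 'k) \<Rightarrow> (('h \<times> 'h) \<Rightarrow>\<^sub>0 'k) set" where
  "cls2 u = u +o null2"

definition tensor2 :: "(('h \<times> 'h) \<Rightarrow>\<^sub>0 'k) set set" where
  "tensor2 = range cls2"

definition null3 :: "(('h \<times> 'h \<times> 'h) \<Rightarrow>\<^sub>0 'k) set" where
  "null3 = module.span pm_scale
     ({gen (x + x', y, z) - gen (x, y, z) - gen (x', y, z) | x x' y z. True}
    \<union> {gen (x, y + y', z) - gen (x, y, z) - gen (x, y', z) | x y y' z. True}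
    \<union> {gen (x, y, z + z') - gen (x, y, z) - gen (x, y, z') | x y z z'. True}
    \<union> {gen (scaleH c x, y, z) - pm_scale c (gen (x, y, z)) | c x y z. True}
    \<union> {gen (x, scaleH c y, z) - pm_scale c (gen (x, y, z)) | c x y z. True}
    \<union> {gen (x, y, scaleH c z) - pm_scale c (gen (x, y, z)) | c x y z. True}
    \<union> {gen (t b * x, y, z) - gen (x, s b * y, z) | b x y z. True}
    \<union> {gen (x, t b * y, z) - gen (x, y, s b * z) | b x y z. True})"

definition cls3 :: "(('h \<times> 'h \<times> 'h) \<Rightarrow>\<^sub>0 'k) \<Rightarrow> (('h \<times> 'h \<times> 'h) \<Rightarrow>\<^sub>0 'k) set" where
  "cls3 u = u +o null3"

text \<open>\<open>rep X\<close> is an arbitrary formal sum representing the tensor \<open>X\<close>. It is only fed into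
  expressions that do not depend on the chosen representative.\<close>

definition rep :: "(('h \<times> 'h) \<Rightarrow>\<^sub>0 'k) set \<Rightarrow> (('h \<times> 'h) \<Rightarrow>\<^sub>0 'k)" where
  "rep X = (SOME u. u \<in> X)"

text \<open>The multiplication of the algebra \<open>H \<otimes> H\<close>, on formal sums.\<close>

definition mult2 :: "(('h \<times> 'h) \<Rightarrow>\<^sub>0 'k) \<Rightarrow> (('h \<times> 'h) \<Rightarrow>\<^sub>0 'k) \<Rightarrow> (('h \<times> 'h) \<Rightarrow>\<^sub>0 'k)" where
  "mult2 u v = pm_ext (\<lambda>(x, y). pm_ext (\<lambda>(x', y'). gen (x * x', y * y')) v) u"

text \<open>Takeuchi's product. Right multiplication by \<open>t b\<close> on the first or by \<open>s b\<close> on the second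
  factor is well defined on \<open>H \<otimes>\<^sub>B H\<close> because its relations only involve left multiplication.\<close>

definition takeuchi :: "(('h \<times> 'h) \<Rightarrow>\<^sub>0 'k) set set" where
  "takeuchi = {X \<in> tensor2. \<forall>b. cls2 (mult2 (rep X) (gen (t b, 1))) =
                                    cls2 (mult2 (rep X) (gen (1, s b)))}"

end


section \<open>Left bialgebroids\<close>

text \<open>\<open>rep (\<Delta> h)\<close> is a formal sum in \<open>H \<otimes> H\<close> representing \<open>h\<^sub>(\<^sub>1\<^sub>) \<otimes>\<^sub>B h\<^sub>(\<^sub>2\<^sub>)\<close>. An expression
  \<open>F h\<^sub>(\<^sub>1\<^sub>) h\<^sub>(\<^sub>2\<^sub>)\<close> is rendered as \<open>lin_ext _ (\<lambda>(x, y). F x y) (rep (\<Delta> h))\<close>; where one is used, \<open>F\<close> is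
  bilinear and balanced over \<open>B\<close>, so that it does not matter which representative is taken.
  The axioms \<open>Delta_add\<close> and \<open>Delta_scale\<close> state linearity over the base field,
  \<open>Delta_bimodule\<close> and \<open>eps_bimodule\<close> compatibility with the bimodule structures
  \<open>b h b' = s b t b' h\<close> on \<open>H\<close> and \<open>b (x \<otimes>\<^sub>B y) b' = s b x \<otimes>\<^sub>B t b' y\<close> on \<open>H \<otimes>\<^sub>B H\<close>.\<close>

locale bialgebroid = Be_ring scaleB scaleH s t
  for scaleB :: "'k::field \<Rightarrow> 'b::{ring, monoid_mult} \<Rightarrow> 'b"
    and scaleH :: "'k \<Rightarrow> 'h::{ring, monoid_mult} \<Rightarrow> 'h"
    and s :: "'b \<Rightarrow> 'h" and t :: "'b \<Rightarrow> 'h" +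
  fixes \<Delta> :: "'h \<Rightarrow> (('h \<times> 'h) \<Rightarrow>\<^sub>0 'k) set" and \<epsilon> :: "'h \<Rightarrow> 'b"
  assumes Delta_tensor: "\<Delta> h \<in> tensor2"
    and Delta_add: "\<Delta> (h + h') = cls2 (rep (\<Delta> h) + rep (\<Delta> h'))"
    and Delta_scale: "\<Delta> (scaleH c h) = cls2 (pm_scale c (rep (\<Delta> h)))"
    and Delta_bimodule:
      "\<Delta> (s b * t b' * h) = cls2 (pm_ext (\<lambda>(x, y). gen (s b * x, t b' * y)) (rep (\<Delta> h)))"
    and eps_linear: "Vector_Spaces.linear scaleH scaleB \<epsilon>"
    and eps_bimodule: "\<epsilon> (s b * t b' * h) = b * \<epsilon> h * b'"
    and coassoc:
      "cls3 (pm_ext (\<lambda>(x, y). pm_ext (\<lambda>(x1, x2). gen (x1, x2, y)) (rep (\<Delta> x))) (rep (\<Delta> h))) =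
       cls3 (pm_ext (\<lambda>(x, y). pm_ext (\<lambda>(y1, y2). gen (x, y1, y2)) (rep (\<Delta> y))) (rep (\<Delta> h)))"
    and counit_left: "lin_ext scaleH (\<lambda>(x, y). s (\<epsilon> x) * y) (rep (\<Delta> h)) = h"
    and counit_right: "lin_ext scaleH (\<lambda>(x, y). t (\<epsilon> y) * x) (rep (\<Delta> h)) = h"
    and Delta_takeuchi: "\<Delta> h \<in> takeuchi"
    and Delta_one: "\<Delta> 1 = cls2 (gen (1, 1))"
    and Delta_mult: "\<Delta> (h * h') = cls2 (mult2 (rep (\<Delta> h)) (rep (\<Delta> h')))"
    and eps_one: "\<epsilon> 1 = 1"
    and eps_mult_source: "\<epsilon> (h * h') = \<epsilon> (h * s (\<epsilon> h'))"
    and eps_mult_target: "\<epsilon> (h * h') = \<epsilon> (h * t (\<epsilon> h'))"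
begin

subsection \<open>Antipodes\<close>

text \<open>In both identities the right multiplication by \<open>h\<^sub>(\<^sub>2\<^sub>) \<otimes> 1\<close> and \<open>1 \<otimes> h\<^sub>(\<^sub>1\<^sub>)\<close> is well
  defined on \<open>H \<otimes>\<^sub>B H\<close>, and the resulting expressions are balanced because
  \<open>S \<circ> t = s\<close>, \<open>\<Delta> (x s b) = \<Delta> x (s b \<otimes> 1)\<close> and \<open>\<Delta> (x t b) = \<Delta> x (1 \<otimes> t b)\<close>.\<close>

definition antipode :: "('h \<Rightarrow> 'h) \<Rightarrow> bool" where
  "antipode S \<longleftrightarrow>
     bij S \<and> anti_algebra_morphism scaleH scaleH S \<and> S \<circ> t = s \<and>
     (\<forall>h. cls2 (pm_ext (\<lambda>(x, y). pm_ext (\<lambda>(u, v). gen (u * y, v)) (rep (\<Delta> (S x)))) (rep (\<Delta> h)))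
          = cls2 (gen (1, S h))) \<and>
     (\<forall>h. cls2 (pm_ext (\<lambda>(x, y). pm_ext (\<lambda>(u, v). gen (u, v * x)) (rep (\<Delta> (inv S y)))) (rep (\<Delta> h)))
          = cls2 (gen (inv S h, 1)))"

subsection \<open>Twists\<close>

definition conv_alg :: "('h \<Rightarrow> 'b) set" where
  "conv_alg = {\<phi>. Vector_Spaces.linear scaleH scaleB \<phi> \<and> (\<forall>b h. \<phi> (t b * h) = \<phi> h * b)}"

definition act :: "'h \<Rightarrow> ('h \<Rightarrow> 'b) \<Rightarrow> 'h" where
  "act h \<phi> = lin_ext scaleH (\<lambda>(x, y). s (\<phi> x) * y) (rep (\<Delta> h))"

definition conv :: "('h \<Rightarrow> 'b) \<Rightarrow> ('h \<Rightarrow> 'b) \<Rightarrow> ('h \<Rightarrow> 'b)" where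
  "conv \<phi> \<psi> = (\<lambda>h. \<psi> (lin_ext scaleH (\<lambda>(x, y). s (\<phi> x) * y) (rep (\<Delta> h))))"

definition twists :: "('h \<Rightarrow> 'b) set" where
  "twists = {\<phi> \<in> conv_alg. (\<exists>\<psi>\<in>conv_alg. conv \<phi> \<psi> = \<epsilon> \<and> conv \<psi> \<phi> = \<epsilon>) \<and>
     act 1 \<phi> = 1 \<and> (\<forall>h h'. act h \<phi> * act h' \<phi> = act (h * h') \<phi>)}"

end

locale full_Hopf_algebroid = bialgebroid scaleB scaleH s t \<Delta> \<epsilon>
  for scaleB :: "'k::field \<Rightarrow> 'b::{ring, monoid_mult} \<Rightarrow> 'b"
    and scaleH :: "'k \<Rightarrow> 'h::{ring, monoid_mult} \<Rightarrow> 'h"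
    and s t \<Delta> \<epsilon> +
  fixes S :: "'h \<Rightarrow> 'h"
  assumes antipode: "antipode S"

end

theory Submission
  imports Defs
begin

text \<open>If \<open>\<phi>\<close> is a twist, coassociativity gives \<open>\<Delta> (h \<triangleleft> \<phi>) = (h\<^sub>(\<^sub>1\<^sub>) \<triangleleft> \<phi>) \<otimes> h\<^sub>(\<^sub>2\<^sub>)\<close>, so the antipode
  identities of \<open>S\<close>, read at \<open>h \<triangleleft> \<phi>\<close>, become those of \<open>h \<mapsto> S (h \<triangleleft> \<phi>)\<close>. Conversely, for antipodes
  \<open>S\<close> and \<open>S'\<close> the algebra automorphism \<open>\<alpha> = inv S \<circ> S'\<close> satisfies \<open>\<Delta> (\<alpha> h) = \<alpha> h\<^sub>(\<^sub>1\<^sub>) \<otimes> h\<^sub>(\<^sub>2\<^sub>)\<close>, as one sees by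
  combining the first identity of \<open>S'\<close> with the second one of \<open>S\<close>; by counitality \<open>\<alpha>\<close> is then the
  action of \<open>\<epsilon> \<circ> \<alpha>\<close>.\<close>

section \<open>Linear extension\<close>

interpretation pm: vector_space "pm_scale :: 'k::field \<Rightarrow> ('x \<Rightarrow>\<^sub>0 'k) \<Rightarrow> _"
  by (rule vector_space_pm_scale)

lemma lookup_pm_scale [simp]: "Poly_Mapping.lookup (pm_scale c u) p = c * Poly_Mapping.lookup u p"
  by (simp add: pm_scale_def Poly_Mapping.map.rep_eq when_def)

lemma linear_lin_ext_apply:
  assumes "Vector_Spaces.linear scV scW F"
  shows "F (lin_ext scV f u) = lin_ext scW (\<lambda>p. F (f p)) u"
proof -
  interpret F: Vector_Spaces.linear scV scW F by fact
  show ?thesis by (simp add: lin_ext_def F.sum F.scale)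
qed

context vector_space
begin

lemma lin_ext_superset:
  assumes "finite A" "Poly_Mapping.keys u \<subseteq> A"
  shows "lin_ext scale f u = (\<Sum>p\<in>A. scale (Poly_Mapping.lookup u p) (f p))"
  unfolding lin_ext_def
  by (rule sum.mono_neutral_left) (use assms in \<open>auto simp: in_keys_iff\<close>)

lemma linear_lin_ext: "Vector_Spaces.linear pm_scale scale (lin_ext scale f)"
proof (rule Vector_Spaces.linear_iff [THEN iffD2], intro conjI allI)
  show "vector_space pm_scale" by (rule vector_space_pm_scale)
  show "vector_space scale" by (rule vector_space_axioms)
  fix u v :: "'c \<Rightarrow>\<^sub>0 'a" and c
  let ?A = "Poly_Mapping.keys u \<union> Poly_Mapping.keys v"
  have "Poly_Mapping.keys (u + v) \<subseteq> ?A" by (rule Poly_Mapping.keys_add)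
  then show "lin_ext scale f (u + v) = lin_ext scale f u + lin_ext scale f v"
    by (simp add: lin_ext_superset [of ?A] lookup_add scale_left_distrib sum.distrib)
  have "Poly_Mapping.keys (pm_scale c u) \<subseteq> Poly_Mapping.keys u"
    by (auto simp: in_keys_iff)
  then show "lin_ext scale f (pm_scale c u) = scale c (lin_ext scale f u)"
    by (simp add: lin_ext_superset [of "Poly_Mapping.keys u"] scale_sum_right)
qed

lemma lin_ext_gen [simp]: "lin_ext scale f (gen p) = f p"
  by (simp add: lin_ext_def gen_def)

lemma lin_ext_add: "lin_ext scale f (u + v) = lin_ext scale f u + lin_ext scale f v"
  and lin_ext_diff: "lin_ext scale f (u - v) = lin_ext scale f u - lin_ext scale f v"
  and lin_ext_scale: "lin_ext scale f (pm_scale c u) = scale c (lin_ext scale f u)"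
proof -
  interpret F: Vector_Spaces.linear pm_scale scale "lin_ext scale f" by (rule linear_lin_ext)
  show "lin_ext scale f (u + v) = lin_ext scale f u + lin_ext scale f v"
    "lin_ext scale f (u - v) = lin_ext scale f u - lin_ext scale f v"
    "lin_ext scale f (pm_scale c u) = scale c (lin_ext scale f u)"
    by (simp_all add: F.add F.diff F.scale)
qed

lemma lin_ext_lin_ext:
  "lin_ext scale f (pm_ext g u) = lin_ext scale (\<lambda>p. lin_ext scale f (g p)) u"
  by (rule linear_lin_ext_apply [OF linear_lin_ext])

lemma lin_ext_swap:
  "lin_ext scale (\<lambda>p. lin_ext scale (\<lambda>q. f p q) v) u =
   lin_ext scale (\<lambda>q. lin_ext scale (\<lambda>p. f p q) u) v"
  unfolding lin_ext_def scale_sum_right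
  by (subst sum.swap) (simp add: mult.commute)

lemma lin_ext_fun_add:
  "lin_ext scale f u + lin_ext scale g u = lin_ext scale (\<lambda>p. f p + g p) u"
  by (simp add: lin_ext_def scale_right_distrib sum.distrib)

lemma lin_ext_fun_scale: "scale c (lin_ext scale f u) = lin_ext scale (\<lambda>p. scale c (f p)) u"
  by (simp add: lin_ext_def scale_sum_right mult.commute)

lemma lin_ext_cong_mod:
  assumes "subspace W" "\<And>p. f p - g p \<in> W"
  shows "lin_ext scale f u - lin_ext scale g u \<in> W"
  unfolding lin_ext_def sum_subtractf [symmetric] scale_right_diff_distrib [symmetric]
  by (intro subspace_sum subspace_scale assms)

end

lemma pm_ext_gen: "pm_ext gen u = u"
proof -
  have "Poly_Mapping.lookup (pm_ext gen u) q = Poly_Mapping.lookup u q" for q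
    by (cases "q \<in> Poly_Mapping.keys u")
      (auto simp: lin_ext_def gen_def lookup_sum lookup_single when_def in_keys_iff
        if_distrib sum.delta cong: if_cong)
  then show ?thesis by (rule poly_mapping_eqI)
qed


section \<open>Maps out of tensor products over the base\<close>

context Be_ring
begin

text \<open>The preimage of \<open>W\<close> under a linear extension is a subspace, so it suffices
  to send the spanning relations into \<open>W\<close>. Working modulo \<open>W\<close> covers maps
  to a vector space (\<open>W = {0}\<close>) as well as maps to another balanced tensor product
  (\<open>W = null2\<close>).\<close>

lemma lin_ext_null2:
  assumes V: "vector_space scV" and W: "module.subspace scV W"
    and add1: "\<And>x x' y. f (x + x') y - f x y - f x' y \<in> W"
    and add2: "\<And>x y y'. f x (y + y') - f x y - f x y' \<in> W"
    and scale1: "\<And>c x y. f (scaleH c x) y - scV c (f x y) \<in> W"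
    and scale2: "\<And>c x y. f x (scaleH c y) - scV c (f x y) \<in> W"
    and bal: "\<And>b x y. f (t b * x) y - f x (s b * y) \<in> W"
    and u: "u \<in> null2"
  shows "lin_ext scV (\<lambda>(x, y). f x y) u \<in> W"
proof -
  interpret V: vector_space scV by fact
  have sub: "pm.subspace {u. lin_ext scV (\<lambda>(x, y). f x y) u \<in> W}"
  proof -
    interpret F: Vector_Spaces.linear pm_scale scV "lin_ext scV (\<lambda>(x, y). f x y)"
      by (rule V.linear_lin_ext)
    show ?thesis by (rule F.subspace_vimage [OF W, unfolded vimage_def])
  qed
  have "null2 \<subseteq> {u. lin_ext scV (\<lambda>(x, y). f x y) u \<in> W}"
    unfolding null2_def
    by (rule pm.span_minimal [OF _ sub])
      (auto simp: V.lin_ext_diff V.lin_ext_scale add1 add2 scale1 scale2 bal)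
  then show ?thesis using u by blast
qed

text \<open>Threefold analogue, through which coassociativity can be contracted to an identity
  between twofold tensors.\<close>

lemma lin_ext_null3:
  assumes V: "vector_space scV" and W: "module.subspace scV W"
    and add1: "\<And>x x' y z. f (x + x') y z - f x y z - f x' y z \<in> W"
    and add2: "\<And>x y y' z. f x (y + y') z - f x y z - f x y' z \<in> W"
    and add3: "\<And>x y z z'. f x y (z + z') - f x y z - f x y z' \<in> W"
    and scale1: "\<And>c x y z. f (scaleH c x) y z - scV c (f x y z) \<in> W"
    and scale2: "\<And>c x y z. f x (scaleH c y) z - scV c (f x y z) \<in> W"
    and scale3: "\<And>c x y z. f x y (scaleH c z) - scV c (f x y z) \<in> W"
    and bal1: "\<And>b x y z. f (t b * x) y z - f x (s b * y) z \<in> W"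
    and bal2: "\<And>b x y z. f x (t b * y) z - f x y (s b * z) \<in> W"
    and u: "u \<in> null3"
  shows "lin_ext scV (\<lambda>(x, y, z). f x y z) u \<in> W"
proof -
  interpret V: vector_space scV by fact
  have sub: "pm.subspace {u. lin_ext scV (\<lambda>(x, y, z). f x y z) u \<in> W}"
  proof -
    interpret F: Vector_Spaces.linear pm_scale scV "lin_ext scV (\<lambda>(x, y, z). f x y z)"
      by (rule V.linear_lin_ext)
    show ?thesis by (rule F.subspace_vimage [OF W, unfolded vimage_def])
  qed
  have "null3 \<subseteq> {u. lin_ext scV (\<lambda>(x, y, z). f x y z) u \<in> W}"
    unfolding null3_def
    by (rule pm.span_minimal [OF _ sub])
      (auto simp: V.lin_ext_diff V.lin_ext_scale add1 add2 add3 scale1 scale2 scale3 bal1 bal2)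
  then show ?thesis using u by blast
qed

section \<open>Congruence of formal sums modulo the relations of the balanced tensor product\<close>

definition eqv2 :: "(('h \<times> 'h) \<Rightarrow>\<^sub>0 'k) \<Rightarrow> (('h \<times> 'h) \<Rightarrow>\<^sub>0 'k) \<Rightarrow> bool" (infix "\<approx>" 50) where
  "u \<approx> v \<longleftrightarrow> u - v \<in> null2"

lemma subspace_null2: "pm.subspace null2"
  unfolding null2_def by (rule pm.subspace_span)

lemma subspace_null3: "pm.subspace null3"
  unfolding null3_def by (rule pm.subspace_span)

lemma eqv2_refl [simp]: "u \<approx> u"
  by (simp add: eqv2_def pm.subspace_0 subspace_null2)

lemma eqv2_sym: "u \<approx> v \<Longrightarrow> v \<approx> u"
  using pm.subspace_neg [OF subspace_null2, of "u - v"] by (simp add: eqv2_def)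

lemma eqv2_trans [trans]: "u \<approx> v \<Longrightarrow> v \<approx> w \<Longrightarrow> u \<approx> w"
  using pm.subspace_add [OF subspace_null2, of "u - v" "v - w"] by (simp add: eqv2_def)

lemma eqv2_add: "u \<approx> u' \<Longrightarrow> v \<approx> v' \<Longrightarrow> u + v \<approx> u' + v'"
  using pm.subspace_add [OF subspace_null2, of "u - u'" "v - v'"]
  by (simp add: eqv2_def algebra_simps)

lemma mem_cls2_iff: "u \<in> cls2 v \<longleftrightarrow> u \<approx> v"
  by (force simp: cls2_def eqv2_def elt_set_plus_def algebra_simps)

lemma cls2_eq_iff: "cls2 u = cls2 v \<longleftrightarrow> u \<approx> v"
proof
  assume "cls2 u = cls2 v"
  then have "u \<in> cls2 v" using mem_cls2_iff [of u u] by simp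
  then show "u \<approx> v" by (simp add: mem_cls2_iff)
next
  assume "u \<approx> v"
  then show "cls2 u = cls2 v"
    by (meson eqv2_sym eqv2_trans mem_cls2_iff set_eqI)
qed

lemma cls3_eqD: "cls3 u = cls3 v \<Longrightarrow> u - v \<in> null3"
proof -
  assume eq: "cls3 u = cls3 v"
  have "u \<in> cls3 u"
    using pm.subspace_0 [OF subspace_null3] by (force simp: cls3_def elt_set_plus_def)
  then have "u \<in> cls3 v" using eq by simp
  then show ?thesis by (auto simp: cls3_def elt_set_plus_def)
qed

text \<open>A coset is nonempty, so the choice made by \<open>rep\<close> lies in it, and every
  member of a coset represents it.\<close>

lemma cls2_rep: "X \<in> tensor2 \<Longrightarrow> cls2 (rep X) = X"
proof -
  assume "X \<in> tensor2"
  then obtain u where X: "X = cls2 u" by (auto simp: tensor2_def)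
  then have "u \<in> X" by (simp add: mem_cls2_iff)
  then have "rep X \<in> X" unfolding rep_def by (rule someI)
  then show ?thesis using X by (simp add: mem_cls2_iff cls2_eq_iff)
qed

lemma eqv2_gen_add1: "gen (x + x', y) \<approx> gen (x, y) + gen (x', y)"
  unfolding eqv2_def null2_def diff_diff_eq [symmetric] by (rule pm.span_base) blast

lemma eqv2_gen_add2: "gen (x, y + y') \<approx> gen (x, y) + gen (x, y')"
  unfolding eqv2_def null2_def diff_diff_eq [symmetric] by (rule pm.span_base) blast

lemma eqv2_gen_scale1: "gen (scaleH c x, y) \<approx> pm_scale c (gen (x, y))"
  unfolding eqv2_def null2_def by (rule pm.span_base) blast

lemma eqv2_gen_scale2: "gen (x, scaleH c y) \<approx> pm_scale c (gen (x, y))"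
  unfolding eqv2_def null2_def by (rule pm.span_base) blast

lemma eqv2_gen_balanced: "gen (t b * x, y) \<approx> gen (x, s b * y)"
  unfolding eqv2_def null2_def by (rule pm.span_base) blast

text \<open>The case \<open>W = null2\<close>: a bilinear balanced map into formal sums induces a
  map on classes.\<close>

lemma eqv2_lin_ext:
  assumes add1: "\<And>x x' y. f (x + x') y \<approx> f x y + f x' y"
    and add2: "\<And>x y y'. f x (y + y') \<approx> f x y + f x y'"
    and scale1: "\<And>c x y. f (scaleH c x) y \<approx> pm_scale c (f x y)"
    and scale2: "\<And>c x y. f x (scaleH c y) \<approx> pm_scale c (f x y)"
    and bal: "\<And>b x y. f (t b * x) y \<approx> f x (s b * y)"
    and uv: "u \<approx> v"
  shows "pm_ext (\<lambda>(x, y). f x y) u \<approx> pm_ext (\<lambda>(x, y). f x y) v"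
  unfolding eqv2_def pm.lin_ext_diff [symmetric]
  by (rule lin_ext_null2 [OF vector_space_pm_scale subspace_null2])
    (use assms in \<open>simp_all add: eqv2_def diff_diff_eq\<close>)

lemma lin_ext_eq_of_eqv2:
  assumes V: "vector_space scV"
    and add1: "\<And>x x' y. f (x + x') y = f x y + f x' y"
    and add2: "\<And>x y y'. f x (y + y') = f x y + f x y'"
    and scale1: "\<And>c x y. f (scaleH c x) y = scV c (f x y)"
    and scale2: "\<And>c x y. f x (scaleH c y) = scV c (f x y)"
    and bal: "\<And>b x y. f (t b * x) y = f x (s b * y)"
    and uv: "u \<approx> v"
  shows "lin_ext scV (\<lambda>(x, y). f x y) u = lin_ext scV (\<lambda>(x, y). f x y) v"
proof -
  interpret V: vector_space scV by fact
  have "lin_ext scV (\<lambda>(x, y). f x y) (u - v) \<in> {0}"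
    by (rule lin_ext_null2 [OF V V.subspace_single_0])
      (use assms in \<open>simp_all add: eqv2_def\<close>)
  then show ?thesis by (simp add: V.lin_ext_diff)
qed

lemma eqv2_lin_ext_pointwise:
  assumes "\<And>p. f p \<approx> g p"
  shows "pm_ext f u \<approx> pm_ext g u"
  unfolding eqv2_def
  by (rule pm.lin_ext_cong_mod [OF subspace_null2]) (use assms in \<open>simp add: eqv2_def\<close>)

lemma eqv2_lin_ext_cong:
  assumes "\<And>x y. f x y \<approx> g x y"
  shows "pm_ext (\<lambda>(x, y). f x y) u \<approx> pm_ext (\<lambda>(x, y). g x y) u"
  by (rule eqv2_lin_ext_pointwise) (use assms in auto)

end

section \<open>Componentwise right multiplication\<close>

definition rmul :: "'h::{ring, monoid_mult} \<Rightarrow> 'h \<Rightarrow> (('h \<times> 'h) \<Rightarrow>\<^sub>0 'k::field) \<Rightarrow> (('h \<times> 'h) \<Rightarrow>\<^sub>0 'k)" where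
  "rmul p q u = pm_ext (\<lambda>(x, y). gen (x * p, y * q)) u"

lemma rmul_gen [simp]: "rmul p q (gen (x, y)) = gen (x * p, y * q)"
  by (simp add: rmul_def)

lemma rmul_lin_ext: "rmul p q (pm_ext f u) = pm_ext (\<lambda>z. rmul p q (f z)) u"
  unfolding rmul_def by (rule pm.lin_ext_lin_ext)

lemma rmul_one [simp]: "rmul 1 1 u = u"
  using pm_ext_gen [of u] by (simp add: rmul_def case_prod_unfold)

lemma rmul_rmul: "rmul p q (rmul p' q' u) = rmul (p' * p) (q' * q) u"
  by (simp add: rmul_def pm.lin_ext_lin_ext case_prod_unfold mult.assoc)

context Be_ring
begin

lemma source_simps: "s 1 = 1" "s (b + b') = s b + s b'" "s (b * b') = s b * s b'"
    "s (scaleB c b) = scaleH c (s b)"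
  using source by (auto simp: algebra_morphism_def Vector_Spaces.linear_iff)

lemma target_one: "t 1 = 1"
  using target by (auto simp: anti_algebra_morphism_def)

text \<open>Interchanging the two sums makes the right factor the outer variable, so its
  representative can be changed by the universal property.\<close>

lemma mult2_eq_lin_ext_rmul: "mult2 u v = pm_ext (\<lambda>(p, q). rmul p q u) v"
proof -
  have "mult2 u v = pm_ext (\<lambda>p. pm_ext (\<lambda>q. gen (fst p * fst q, snd p * snd q)) v) u"
    by (simp add: mult2_def case_prod_unfold)
  also have "\<dots> = pm_ext (\<lambda>q. pm_ext (\<lambda>p. gen (fst p * fst q, snd p * snd q)) u) v"
    by (rule pm.lin_ext_swap)
  finally show ?thesis by (simp add: rmul_def case_prod_unfold)
qed

text \<open>The balancing relations only multiply from the left, hence right multiplication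
  preserves them.\<close>

lemma eqv2_rmul:
  assumes "u \<approx> v"
  shows "rmul p q u \<approx> rmul p q v"
  unfolding rmul_def using assms
  by (rule eqv2_lin_ext [rotated -1])
    (simp_all add: distrib_right H.scale_mult_left mult.assoc eqv2_gen_add1 eqv2_gen_add2
      eqv2_gen_scale1 eqv2_gen_scale2 eqv2_gen_balanced)

lemma rmul_add1: "rmul (p + p') q u \<approx> rmul p q u + rmul p' q u"
  unfolding rmul_def pm.lin_ext_fun_add
  by (auto simp: case_prod_unfold distrib_left intro!: eqv2_lin_ext_pointwise eqv2_gen_add1)

lemma rmul_add2: "rmul p (q + q') u \<approx> rmul p q u + rmul p q' u"
  unfolding rmul_def pm.lin_ext_fun_add
  by (auto simp: case_prod_unfold distrib_left intro!: eqv2_lin_ext_pointwise eqv2_gen_add2)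

lemma rmul_scale1: "rmul (scaleH c p) q u \<approx> pm_scale c (rmul p q u)"
  unfolding rmul_def pm.lin_ext_fun_scale
  by (auto simp: case_prod_unfold H.scale_mult_right intro!: eqv2_lin_ext_pointwise eqv2_gen_scale1)

lemma rmul_scale2: "rmul p (scaleH c q) u \<approx> pm_scale c (rmul p q u)"
  unfolding rmul_def pm.lin_ext_fun_scale
  by (auto simp: case_prod_unfold H.scale_mult_right intro!: eqv2_lin_ext_pointwise eqv2_gen_scale2)

text \<open>Meant for maps such as \<open>\<lambda>h. rep (\<Delta> h)\<close>, which are linear
  only up to congruence because representatives are chosen arbitrarily; hence an induction over the
  support replaces plain linearity.\<close>

lemma eqv2_linear_map_lin_ext:
  assumes add: "\<And>x y. G (x + y) \<approx> G x + G y"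
    and scale: "\<And>c x. G (scaleH c x) \<approx> pm_scale c (G x)"
  shows "G (lin_ext scaleH f u) \<approx> pm_ext (\<lambda>p. G (f p)) u"
proof -
  have "G (\<Sum>p\<in>A. scaleH (g p) (f p)) \<approx> (\<Sum>p\<in>A. pm_scale (g p) (G (f p)))"
    if "finite A" for A g
    using that
  proof (induction A rule: finite_induct)
    case empty
    \<comment> \<open>Scaling by zero yields \<open>G 0 \<approx> 0\<close>.\<close>
    show ?case using scale [of 0 0] by simp
  next
    case (insert a A)
    then show ?case
      by (auto intro: eqv2_trans [OF add] eqv2_add scale)
  qed
  then show ?thesis by (simp add: lin_ext_def)
qed

end


section \<open>Colinearity of the action and of comparisons of antipodes\<close>

context bialgebroid
begin

section \<open>The coproduct on representatives\<close>

abbreviation D :: "'h \<Rightarrow> (('h \<times> 'h) \<Rightarrow>\<^sub>0 'k)" where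
  "D h \<equiv> rep (\<Delta> h)"

lemma Delta_eq_cls2_iff: "\<Delta> h = cls2 u \<longleftrightarrow> D h \<approx> u"
  using cls2_rep [OF Delta_tensor, of h] by (metis cls2_eq_iff)

lemma D_add: "D (h + h') \<approx> D h + D h'"
  using Delta_add by (simp add: Delta_eq_cls2_iff)

lemma D_scale: "D (scaleH c h) \<approx> pm_scale c (D h)"
  using Delta_scale by (simp add: Delta_eq_cls2_iff)

lemma D_source_mult: "D (s b * h) \<approx> pm_ext (\<lambda>(x, y). gen (s b * x, y)) (D h)"
  using Delta_bimodule [of b 1 h] by (simp add: Delta_eq_cls2_iff target_one)

lemma D_target_mult: "D (t b * h) \<approx> pm_ext (\<lambda>(x, y). gen (x, t b * y)) (D h)"
  using Delta_bimodule [of 1 b h] by (simp add: Delta_eq_cls2_iff source_simps)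

lemma D_takeuchi: "rmul (t b) 1 (D h) \<approx> rmul 1 (s b) (D h)"
  using Delta_takeuchi [of h] by (simp add: takeuchi_def cls2_eq_iff mult2_eq_lin_ext_rmul)

lemma D_one: "D 1 \<approx> gen (1, 1)"
  using Delta_one by (simp add: Delta_eq_cls2_iff)

lemma D_mult: "D (h * h') \<approx> mult2 (D h) (D h')"
  using Delta_mult by (simp add: Delta_eq_cls2_iff)

text \<open>The Takeuchi condition, multiplied on the right by \<open>(p, q)\<close>. It makes the
  product of \<open>D h\<close> with a tensor balanced in that tensor.\<close>

lemma rmul_balanced: "rmul (t b * p) q (D h) \<approx> rmul p (s b * q) (D h)"
  using eqv2_rmul [OF D_takeuchi, of p q b h] by (simp add: rmul_rmul)

text \<open>Since \<Delta> takes values in the Takeuchi product, the right factor matters only up to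
  congruence, so a pure tensor may stand for \<open>D h'\<close>.\<close>

lemma D_mult_eqv2_gen:
  assumes "D h' \<approx> gen (p, q)"
  shows "D (h * h') \<approx> rmul p q (D h)"
proof -
  have "mult2 (D h) (D h') \<approx> mult2 (D h) (gen (p, q))"
    unfolding mult2_eq_lin_ext_rmul
    using assms by (rule eqv2_lin_ext [rotated -1])
      (rule rmul_add1 rmul_add2 rmul_scale1 rmul_scale2 rmul_balanced)+
  from eqv2_trans [OF D_mult this] show ?thesis by (simp add: mult2_eq_lin_ext_rmul)
qed

text \<open>Bimodule linearity at the unit gives \<open>D (s b) \<approx> gen (s b, 1)\<close>;
  multiplicativity of \<Delta> does the rest. Sources commute with targets, so left multiplication
  by \<open>s b\<close> on the first factor respects balancing.\<close>

lemma D_mult_source: "D (h * s b) \<approx> rmul (s b) 1 (D h)"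
proof (rule D_mult_eqv2_gen)
  have "D (s b * 1) \<approx> pm_ext (\<lambda>(x, y). gen (s b * x, y)) (D 1)" by (rule D_source_mult)
  also have "\<dots> \<approx> pm_ext (\<lambda>(x, y). gen (s b * x, y)) (gen (1, 1))"
    using D_one
  proof (rule eqv2_lin_ext [rotated -1])
    fix b' x y
    have "s b * (t b' * x) = t b' * (s b * x)"
      by (simp add: source_target_commute flip: mult.assoc)
    then show "gen (s b * (t b' * x), y) \<approx> gen (s b * x, s b' * y)"
      by (simp add: eqv2_gen_balanced)
  qed (simp_all add: distrib_left H.scale_mult_right eqv2_gen_add1 eqv2_gen_add2
      eqv2_gen_scale1 eqv2_gen_scale2)
  finally show "D (s b) \<approx> gen (s b, 1)" by simp
qed

lemma D_mult_target: "D (h * t b) \<approx> rmul 1 (t b) (D h)"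
proof (rule D_mult_eqv2_gen)
  have "D (t b * 1) \<approx> pm_ext (\<lambda>(x, y). gen (x, t b * y)) (D 1)" by (rule D_target_mult)
  also have "\<dots> \<approx> pm_ext (\<lambda>(x, y). gen (x, t b * y)) (gen (1, 1))"
    using D_one
  proof (rule eqv2_lin_ext [rotated -1])
    fix b' x y
    have "t b * (s b' * y) = s b' * (t b * y)"
      by (simp add: source_target_commute flip: mult.assoc)
    then show "gen (t b' * x, t b * y) \<approx> gen (x, t b * (s b' * y))"
      by (simp add: eqv2_gen_balanced)
  qed (simp_all add: distrib_left H.scale_mult_right eqv2_gen_add1 eqv2_gen_add2
      eqv2_gen_scale1 eqv2_gen_scale2)
  finally show "D (t b) \<approx> gen (1, t b)" by simp
qed

section \<open>The right action of the convolution algebra\<close>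

lemma conv_alg_simps:
  assumes "\<phi> \<in> conv_alg"
  shows "\<phi> (x + y) = \<phi> x + \<phi> y" "\<phi> (scaleH c x) = scaleB c (\<phi> x)" "\<phi> (t b * x) = \<phi> x * b"
  using assms by (auto simp: conv_alg_def Vector_Spaces.linear_iff)

lemma eps_conv_alg: "\<epsilon> \<in> conv_alg"
  using eps_linear eps_bimodule [of 1] eps_one by (simp add: conv_alg_def source_simps)

text \<open>Right linearity of \<phi> turns \<open>s (\<phi> (t b * x)) * y\<close> into
  \<open>s (\<phi> x) * (s b * y)\<close>, which is the required balancing.\<close>

lemma act_cong:
  assumes "\<phi> \<in> conv_alg" "u \<approx> v"
  shows "lin_ext scaleH (\<lambda>(x, y). s (\<phi> x) * y) u = lin_ext scaleH (\<lambda>(x, y). s (\<phi> x) * y) v"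
  using assms(2)
  by (rule lin_ext_eq_of_eqv2 [OF H.vector_space_axioms, rotated -1])
    (simp_all add: conv_alg_simps [OF assms(1)] source_simps algebra_simps
      H.scale_mult_left H.scale_mult_right)

lemma act_eq:
  assumes "\<phi> \<in> conv_alg" "D h \<approx> u"
  shows "act h \<phi> = lin_ext scaleH (\<lambda>(x, y). s (\<phi> x) * y) u"
  unfolding act_def by (rule act_cong [OF assms])

lemma conv_apply: "conv \<phi> \<psi> h = \<psi> (act h \<phi>)"
  by (simp add: conv_def act_def)

lemma act_eps [simp]: "act h \<epsilon> = h"
  unfolding act_def by (rule counit_left)

lemma act_add: "\<phi> \<in> conv_alg \<Longrightarrow> act (h + h') \<phi> = act h \<phi> + act h' \<phi>"
  by (subst act_eq [OF _ D_add]) (simp_all add: H.lin_ext_add act_def)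

lemma act_scale: "\<phi> \<in> conv_alg \<Longrightarrow> act (scaleH c h) \<phi> = scaleH c (act h \<phi>)"
  by (subst act_eq [OF _ D_scale]) (simp_all add: H.lin_ext_scale act_def)

text \<open>\<Delta> moves \<open>t b\<close> to the second factor, where it commutes with the
  source element \<open>s (\<phi> x)\<close>.\<close>

lemma act_target_mult:
  assumes "\<phi> \<in> conv_alg"
  shows "act (t b * h) \<phi> = t b * act h \<phi>"
proof -
  have lin: "Vector_Spaces.linear scaleH scaleH ((*) (t b))"
    by (simp add: Vector_Spaces.linear_iff H.vector_space_axioms distrib_left H.scale_mult_right)
  have "s (\<phi> x) * (t b * y) = t b * (s (\<phi> x) * y)" for x y
    by (simp add: source_target_commute flip: mult.assoc)
  then show ?thesis
    by (subst act_eq [OF assms D_target_mult])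
      (simp add: act_def H.lin_ext_lin_ext case_prod_unfold linear_lin_ext_apply [OF lin])
qed

lemma D_act:
  assumes \<phi>: "\<phi> \<in> conv_alg"
  shows "D (act h \<phi>) \<approx> pm_ext (\<lambda>(x, y). gen (act x \<phi>, y)) (D h)"
proof -
  \<comment> \<open>\<open>?F\<close> contracts the first two legs with \<phi>; \<open>?u\<close>
    and \<open>?v\<close> are the two sides of coassociativity.\<close>
  let ?F = "pm_ext (\<lambda>(x, y, z). gen (s (\<phi> x) * y, z)) :: _ \<Rightarrow> ('h \<times> 'h) \<Rightarrow>\<^sub>0 'k"
  let ?u = "pm_ext (\<lambda>(x, y). pm_ext (\<lambda>(x1, x2). gen (x1, x2, y)) (D x)) (D h)"
  let ?v = "pm_ext (\<lambda>(x, y). pm_ext (\<lambda>(y1, y2). gen (x, y1, y2)) (D y)) (D h)"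
  have "D (act h \<phi>) \<approx> pm_ext (\<lambda>p. D (case p of (x, y) \<Rightarrow> s (\<phi> x) * y)) (D h)"
    unfolding act_def by (rule eqv2_linear_map_lin_ext) (rule D_add D_scale)+
  also have "\<dots> \<approx> ?F ?v"
    by (auto simp: pm.lin_ext_lin_ext case_prod_unfold
        intro!: eqv2_lin_ext_pointwise D_source_mult [unfolded case_prod_unfold])
  also have "?F ?v \<approx> ?F ?u"
  proof (rule eqv2_sym)
    have bal: "s (\<phi> x) * (t b * y) = t b * (s (\<phi> x) * y)" for b x y
      by (simp add: source_target_commute flip: mult.assoc)
    \<comment> \<open>\<open>?F\<close> respects the first balancing by right linearity of \<phi>,
      and the second because targets commute with sources.\<close>
    have "?F (?u - ?v) \<in> null2"
      by (rule lin_ext_null3 [OF vector_space_pm_scale subspace_null2, rotated -1],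
          rule cls3_eqD [OF coassoc])
        (simp_all add: conv_alg_simps [OF \<phi>] source_simps algebra_simps bal
          H.scale_mult_left H.scale_mult_right diff_diff_eq eqv2_gen_add1 eqv2_gen_add2
          eqv2_gen_scale1 eqv2_gen_scale2 eqv2_gen_balanced pm.subspace_0 [OF subspace_null2]
          flip: eqv2_def)
    then show "?F ?u \<approx> ?F ?v" by (simp add: eqv2_def pm.lin_ext_diff)
  qed
  \<comment> \<open>Linearity of the tensor in its first slot, up to congruence, collects the
    contracted sum into \<open>act x \<phi>\<close>.\<close>
  also have "\<dots> \<approx> pm_ext (\<lambda>(x, y). gen (act x \<phi>, y)) (D h)"
    unfolding act_def
    by (auto simp: pm.lin_ext_lin_ext case_prod_unfold
        intro!: eqv2_lin_ext_pointwise eqv2_gen_add1 eqv2_gen_scale1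
          eqv2_sym [OF eqv2_linear_map_lin_ext [where G = "\<lambda>x. gen (x, _)"]])
  finally show ?thesis .
qed

text \<open>By \<open>D_act\<close> the second action evaluates \<psi> at
  \<open>act x \<phi>\<close>, which is \<open>conv \<phi> \<psi> x\<close>.\<close>

lemma act_act:
  assumes "\<phi> \<in> conv_alg" "\<psi> \<in> conv_alg"
  shows "act (act h \<phi>) \<psi> = act h (conv \<phi> \<psi>)"
  by (subst act_eq [OF assms(2) D_act [OF assms(1)]])
    (simp add: act_def [of h "conv \<phi> \<psi>"] H.lin_ext_lin_ext case_prod_unfold conv_apply)

section \<open>The antipode identities as maps on tensors\<close>

definition antipode1 :: "('h \<Rightarrow> 'h) \<Rightarrow> 'h \<times> 'h \<Rightarrow> ('h \<times> 'h) \<Rightarrow>\<^sub>0 'k" where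
  "antipode1 S = (\<lambda>(x, y). rmul y 1 (D (S x)))"

definition antipode2 :: "('h \<Rightarrow> 'h) \<Rightarrow> 'h \<times> 'h \<Rightarrow> ('h \<times> 'h) \<Rightarrow>\<^sub>0 'k" where
  "antipode2 S = (\<lambda>(x, y). rmul 1 x (D (inv S y)))"

text \<open>Separating the maps from their argument \<open>D h\<close> allows them to be applied to
  other tensors, which is how two antipodes are compared.\<close>

lemma antipode_iff:
  "antipode S \<longleftrightarrow> bij S \<and> anti_algebra_morphism scaleH scaleH S \<and> S \<circ> t = s \<and>
    (\<forall>h. pm_ext (antipode1 S) (D h) \<approx> gen (1, S h)) \<and>
    (\<forall>h. pm_ext (antipode2 S) (D h) \<approx> gen (inv S h, 1))"
  unfolding antipode_def cls2_eq_iff antipode1_def antipode2_def rmul_def by simp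

lemma antipode_simps:
  assumes "antipode S"
  shows "S (x + y) = S x + S y" "S (scaleH c x) = scaleH c (S x)" "S (x * y) = S y * S x"
    "S 1 = 1" "S (t b) = s b" "S (inv S x) = x" "inv S (S x) = x"
    "inv S (x + y) = inv S x + inv S y" "inv S (scaleH c x) = scaleH c (inv S x)"
    "inv S (x * y) = inv S y * inv S x" "inv S 1 = 1" "inv S (s b) = t b"
proof -
  have bij: "bij S" using assms by (simp add: antipode_iff)
  have S: "S (x + y) = S x + S y" "S (scaleH c x) = scaleH c (S x)" "S (x * y) = S y * S x"
    "S 1 = 1" "S (t b) = s b" for x y c b
    using assms
    by (auto simp: antipode_iff anti_algebra_morphism_def Vector_Spaces.linear_iff fun_eq_iff)
  have inv: "S (inv S x) = x" "inv S (S x) = x" for x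
    using bij by (simp_all add: bij_is_inj bij_is_surj surj_f_inv_f)
  have inv_eq: "inv S y = x" if "S x = y" for x y using that inv by metis
  show "S (x + y) = S x + S y" "S (scaleH c x) = scaleH c (S x)" "S (x * y) = S y * S x"
    "S 1 = 1" "S (t b) = s b" "S (inv S x) = x" "inv S (S x) = x"
    by (simp_all add: S inv)
  show "inv S (x + y) = inv S x + inv S y" "inv S (scaleH c x) = scaleH c (inv S x)"
    "inv S (x * y) = inv S y * inv S x" "inv S 1 = 1" "inv S (s b) = t b"
    by (rule inv_eq, simp add: S inv)+
qed

text \<open>For balancing, \<open>S (t b * x) = S x * s b\<close>, and \<Delta> turns right
  multiplication by \<open>s b\<close> into right multiplication of the first factor, where it meets
  \<open>y\<close>.\<close>

lemma eqv2_antipode1: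
  assumes S: "antipode S" and "u \<approx> v"
  shows "pm_ext (antipode1 S) u \<approx> pm_ext (antipode1 S) v"
  unfolding antipode1_def using assms(2)
proof (rule eqv2_lin_ext [rotated -1])
  show "rmul y 1 (D (S (t b * x))) \<approx> rmul (s b * y) 1 (D (S x))" for b x y
    using eqv2_rmul [OF D_mult_source, of y 1 "S x" b]
    by (simp add: antipode_simps [OF S] rmul_rmul)
  show "rmul y 1 (D (S (x + x'))) \<approx> rmul y 1 (D (S x)) + rmul y 1 (D (S x'))" for x x' y
    using eqv2_rmul [OF D_add, of y 1 "S x" "S x'"]
    by (simp add: antipode_simps [OF S] rmul_def pm.lin_ext_add)
  show "rmul y 1 (D (S (scaleH c x))) \<approx> pm_scale c (rmul y 1 (D (S x)))" for c x y
    using eqv2_rmul [OF D_scale, of y 1 c "S x"]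
    by (simp add: antipode_simps [OF S] rmul_def pm.lin_ext_scale)
qed (rule rmul_add1 rmul_scale1)+

text \<open>The mirror image: \<open>inv S (s b * y) = inv S y * t b\<close>, and \<open>t b\<close>
  acts on the second factor, in front of \<open>x\<close>.\<close>

lemma eqv2_antipode2:
  assumes S: "antipode S" and "u \<approx> v"
  shows "pm_ext (antipode2 S) u \<approx> pm_ext (antipode2 S) v"
  unfolding antipode2_def using assms(2)
proof (rule eqv2_lin_ext [rotated -1])
  show "rmul 1 (t b * x) (D (inv S y)) \<approx> rmul 1 x (D (inv S (s b * y)))" for b x y
    using eqv2_sym [OF eqv2_rmul [OF D_mult_target, of 1 x "inv S y" b]]
    by (simp add: antipode_simps [OF S] rmul_rmul)
  show "rmul 1 x (D (inv S (y + y'))) \<approx> rmul 1 x (D (inv S y)) + rmul 1 x (D (inv S y'))"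
    for x y y'
    using eqv2_rmul [OF D_add, of 1 x "inv S y" "inv S y'"]
    by (simp add: antipode_simps [OF S] rmul_def pm.lin_ext_add)
  show "rmul 1 x (D (inv S (scaleH c y))) \<approx> pm_scale c (rmul 1 x (D (inv S y)))" for c x y
    using eqv2_rmul [OF D_scale, of 1 x c "inv S y"]
    by (simp add: antipode_simps [OF S] rmul_def pm.lin_ext_scale)
qed (rule rmul_add2 rmul_scale2)+

text \<open>The map \<open>x \<otimes> y \<mapsto> \<Delta> (inv S y) (1 \<otimes> x)\<close> is applied to the first antipode identity of
  \<open>S'\<close>; by the second antipode identity of \<open>S\<close> it undoes
  \<open>x \<otimes> y \<mapsto> \<Delta> (S' x) (y \<otimes> 1)\<close> up to \<open>inv S \<circ> S'\<close> in the first factor.\<close>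

lemma D_antipode_comparison:
  assumes S: "antipode S" and S': "antipode S'"
  shows "D (inv S (S' h)) \<approx> pm_ext (\<lambda>(x, y). gen (inv S (S' x), y)) (D h)"
proof -
  have "D (inv S (S' h)) = pm_ext (antipode2 S) (gen (1, S' h))"
    by (simp add: antipode2_def)
  also have "\<dots> \<approx> pm_ext (antipode2 S) (pm_ext (antipode1 S') (D h))"
    using S' by (intro eqv2_antipode2 [OF S]) (simp add: antipode_iff eqv2_sym)
  \<comment> \<open>The factor \<open>y\<close>, attached on the right of the first leg, reappears
    as a right multiplication of the second leg and can be pulled out. What remains is the second
    identity of \<open>S\<close> at \<open>S' x\<close>.\<close>
  also have "\<dots> = pm_ext (\<lambda>(x, y). rmul 1 y (pm_ext (antipode2 S) (D (S' x)))) (D h)"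
    by (simp add: pm.lin_ext_lin_ext antipode1_def antipode2_def rmul_lin_ext rmul_rmul
        case_prod_unfold)
      (simp add: rmul_def pm.lin_ext_lin_ext case_prod_unfold mult.assoc)
  also have "\<dots> \<approx> pm_ext (\<lambda>(x, y). rmul 1 y (gen (inv S (S' x), 1))) (D h)"
    using S by (intro eqv2_lin_ext_cong eqv2_rmul) (simp add: antipode_iff)
  finally show ?thesis by simp
qed

text \<open>Both antipodes send \<open>t b\<close> to \<open>s b\<close>, so
  \<open>inv S \<circ> S'\<close> commutes with left multiplication by \<open>t b\<close>; this
  gives right linearity. Applying the counit to the first leg of the comparison formula recovers the
  map as an action.\<close>

lemma act_eps_comparison:
  assumes S: "antipode S" and S': "antipode S'"
  shows "\<epsilon> \<circ> (inv S \<circ> S') \<in> conv_alg" "act h (\<epsilon> \<circ> (inv S \<circ> S')) = inv S (S' h)"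
proof -
  show "\<epsilon> \<circ> (inv S \<circ> S') \<in> conv_alg"
    using B.vector_space_axioms H.vector_space_axioms
    by (simp add: conv_alg_def Vector_Spaces.linear_iff antipode_simps [OF S]
        antipode_simps [OF S'] conv_alg_simps [OF eps_conv_alg])
  have "inv S (S' h) = act (inv S (S' h)) \<epsilon>" by simp
  also have "\<dots> = act h (\<epsilon> \<circ> (inv S \<circ> S'))"
    by (subst act_eq [OF eps_conv_alg D_antipode_comparison [OF S S']])
      (simp add: H.lin_ext_lin_ext act_def case_prod_unfold)
  finally show "act h (\<epsilon> \<circ> (inv S \<circ> S')) = inv S (S' h)" by simp
qed

section \<open>Passage between antipodes and twists\<close>

lemma twist_of_antipodes:
  assumes S: "antipode S" and S': "antipode S'"
  shows "\<exists>\<phi>\<in>twists. \<forall>h. S' h = S (act h \<phi>)"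
proof
  \<comment> \<open>The actions of \<open>?\<phi>\<close> and \<open>?\<psi>\<close> are the
    mutually inverse maps \<open>inv S \<circ> S'\<close> and \<open>inv S' \<circ> S\<close>, so
    both convolution products reduce to \<epsilon>.\<close>
  let ?\<phi> = "\<epsilon> \<circ> (inv S \<circ> S')" and ?\<psi> = "\<epsilon> \<circ> (inv S' \<circ> S)"
  note \<phi> = act_eps_comparison [OF S S'] and \<psi> = act_eps_comparison [OF S' S]
  note simps = \<phi>(2) \<psi>(2) antipode_simps [OF S] antipode_simps [OF S']
  have "conv ?\<phi> ?\<psi> = \<epsilon>" "conv ?\<psi> ?\<phi> = \<epsilon>"
    by (simp_all only: fun_eq_iff conv_apply simps comp_apply) simp_all
  \<comment> \<open>The action is multiplicative because it composes two order-reversing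
    maps.\<close>
  then show "?\<phi> \<in> twists"
    using \<phi>(1) \<psi>(1) by (auto simp: twists_def simps simp del: comp_apply)
  show "\<forall>h. S' h = S (act h ?\<phi>)"
    by (simp add: simps del: comp_apply)
qed

lemma antipode_of_twist:
  assumes S: "antipode S" and "\<phi> \<in> twists"
  shows "antipode (\<lambda>h. S (act h \<phi>))"
proof -
  let ?S' = "\<lambda>h. S (act h \<phi>)"
  from assms(2) obtain \<psi> where \<phi>: "\<phi> \<in> conv_alg" and \<psi>: "\<psi> \<in> conv_alg"
    and conv: "conv \<phi> \<psi> = \<epsilon>" "conv \<psi> \<phi> = \<epsilon>"
    and one: "act 1 \<phi> = 1" and mult: "\<And>h h'. act h \<phi> * act h' \<phi> = act (h * h') \<phi>"
    by (auto simp: twists_def)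
  note S_simps = antipode_simps [OF S]
  have inverse: "act (act h \<phi>) \<psi> = h" "act (act h \<psi>) \<phi> = h" for h
    by (simp_all add: act_act \<phi> \<psi> conv)
  have bij: "bij ?S'"
    by (rule o_bij [of "\<lambda>h. act (inv S h) \<psi>"]) (simp_all add: fun_eq_iff S_simps inverse)
  have inv_S': "inv ?S' = (\<lambda>h. act (inv S h) \<psi>)"
    by (rule inv_unique_comp) (simp_all add: fun_eq_iff S_simps inverse)
  \<comment> \<open>Left target linearity of the action reduces this to the fixed unit.\<close>
  have "act (t b) \<phi> = t b" for b
    using act_target_mult [OF \<phi>, of b 1] one by simp
  then have comp: "?S' \<circ> t = s" by (simp add: fun_eq_iff S_simps)
  have anti: "anti_algebra_morphism scaleH scaleH ?S'"
    using H.vector_space_axioms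
    by (simp add: anti_algebra_morphism_def Vector_Spaces.linear_iff act_add \<phi> act_scale
        S_simps one flip: mult)
  \<comment> \<open>Colinearity identifies the left side with the first identity of \<open>S\<close>
    at \<open>act h \<phi>\<close>.\<close>
  have first: "pm_ext (antipode1 ?S') (D h) \<approx> gen (1, ?S' h)" for h
  proof -
    have "pm_ext (antipode1 ?S') (D h) =
        pm_ext (antipode1 S) (pm_ext (\<lambda>(x, y). gen (act x \<phi>, y)) (D h))"
      by (simp add: pm.lin_ext_lin_ext antipode1_def case_prod_unfold)
    also have "\<dots> \<approx> pm_ext (antipode1 S) (D (act h \<phi>))"
      by (intro eqv2_antipode1 [OF S] eqv2_sym [OF D_act] \<phi>)
    also have "\<dots> \<approx> gen (1, ?S' h)" using S by (simp add: antipode_iff)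
    finally show ?thesis .
  qed
  have second: "pm_ext (antipode2 ?S') (D h) \<approx> gen (inv ?S' h, 1)" for h
  proof -
    \<comment> \<open>\<open>?A\<close> acts by the convolution inverse \<psi> on the first leg. It
      commutes with right multiplication on the second leg, so it can be pulled out of the identity
      for \<open>S\<close>, and it carries \<open>inv S h\<close> to
      \<open>inv ?S' h\<close>.\<close>
    let ?A = "pm_ext (\<lambda>(x, y). gen (act x \<psi>, y)) :: _ \<Rightarrow> ('h \<times> 'h) \<Rightarrow>\<^sub>0 'k"
    have A: "?A u \<approx> ?A v" if "u \<approx> v" for u v
      using that by (rule eqv2_lin_ext [rotated -1])
        (simp_all add: act_add act_scale act_target_mult \<psi> eqv2_gen_add1 eqv2_gen_add2
          eqv2_gen_scale1 eqv2_gen_scale2 eqv2_gen_balanced)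
    have rmul_A: "rmul 1 x (?A u) = ?A (rmul 1 x u)" for x u
      by (simp add: rmul_def pm.lin_ext_lin_ext case_prod_unfold)
    have "pm_ext (antipode2 ?S') (D h) \<approx> pm_ext (\<lambda>(x, y). rmul 1 x (?A (D (inv S y)))) (D h)"
      unfolding antipode2_def inv_S' by (intro eqv2_lin_ext_cong eqv2_rmul D_act \<psi>)
    also have "\<dots> = ?A (pm_ext (antipode2 S) (D h))"
      by (subst pm.lin_ext_lin_ext [where g = "antipode2 S"])
        (simp add: rmul_A [unfolded case_prod_unfold] antipode2_def case_prod_unfold)
    also have "\<dots> \<approx> ?A (gen (inv S h, 1))"
      using S by (intro A) (simp add: antipode_iff)
    finally show ?thesis by (simp add: inv_S')
  qed
  show ?thesis using bij anti comp first second by (simp add: antipode_iff)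
qed

end

theorem theorem2p12:
  fixes scaleB :: "'k::field \<Rightarrow> 'b::{ring, monoid_mult} \<Rightarrow> 'b"
    and scaleH :: "'k \<Rightarrow> 'h::{ring, monoid_mult} \<Rightarrow> 'h"
    and s t :: "'b \<Rightarrow> 'h"
    and \<Delta> :: "'h \<Rightarrow> (('h \<times> 'h) \<Rightarrow>\<^sub>0 'k) set"
    and \<epsilon> :: "'h \<Rightarrow> 'b"
    and S S' :: "'h \<Rightarrow> 'h"
  assumes "full_Hopf_algebroid scaleB scaleH s t \<Delta> \<epsilon> S"
  shows "full_Hopf_algebroid scaleB scaleH s t \<Delta> \<epsilon> S' \<longleftrightarrow>
    (\<exists>\<phi> \<in> bialgebroid.twists scaleB scaleH s t \<Delta> \<epsilon>.
       \<forall>h. S' h = S (bialgebroid.act scaleH s \<Delta> h \<phi>))"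
proof -
  interpret full_Hopf_algebroid scaleB scaleH s t \<Delta> \<epsilon> S by fact
  have "full_Hopf_algebroid scaleB scaleH s t \<Delta> \<epsilon> S' \<longleftrightarrow> antipode S'"
    by (simp add: full_Hopf_algebroid_def full_Hopf_algebroid_axioms_def bialgebroid_axioms)
  \<comment> \<open>The pointwise equation is read as an equality of functions, so the antipode
    property transfers to \<open>S'\<close>.\<close>
  also have "\<dots> \<longleftrightarrow> (\<exists>\<phi>\<in>twists. \<forall>h. S' h = S (act h \<phi>))"
    using twist_of_antipodes [OF antipode] antipode_of_twist [OF antipode]
    by (auto simp flip: fun_eq_iff)
  finally show ?thesis .
qed

end
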